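(* Let $(Q_n)_{n\in\mathbb{Z}}$ be the Pell-Lucas numbers, i.e. the integer sequence determined by $Q_0=2$, $Q_1=2$ and $Q_n=2Q_{n-1}+Q_{n-2}$ for all $n\in\mathbb{Z}$. For a positive integer $k$ and $z\in\mathbb{C}\setminus\mathbb{R}$ let $$Q_{2k}(z):=\sum_{j=-\infty}^{\infty}\left(Q_j z+Q_{j-1}\right)^{-2k}.$$ Then for every positive integer $k$ and every $z\in\mathbb{C}\setminus\mathbb{R}$: (i) $Q_{2k}\!\left(-\tfrac{1}{z}\right)=z^{2k}Q_{2k}(z)$; (ii) $Q_{2k}(2-z)=Q_{2k}(z)$; (iii) $Q_{2k}(z+2)=z^{-2k}Q_{2k}\!\left(\tfrac{1}{z}\right)$; (iv) $Q_{2k}(-z)=z^{-2k}Q_{2k}\!\left(\tfrac{1}{z}\right)$.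
   Context: The Pell-Lucas numbers: $Q_0=Q_1=2$, $Q_n=2Q_{n-1}+Q_{n-2}$, extended to all integer indices via the same recurrence; thus $Q_2=6$, $Q_3=14$, $Q_4=34,\dots$ and $Q_{-1}=-2$, $Q_{-2}=6,\dots$. The Pell-Lucas-Eisenstein series of weight $m$ is the two-sided series $Q_m(z)=\sum_{j\in\mathbb{Z}}(Q_jz+Q_{j-1})^{-m}$, which converges for integer $m>1$ and $z\in\mathbb{C}\setminus\mathbb{R}$. *)

theory Defs
  imports "HOL-Analysis.Infinite_Sum"
begin

(* For n < 0 the recurrence is run backwards: Q(n) = Q(n+2) - 2 Q(n+1). *)
function pell_lucas :: "int \<Rightarrow> int" where
  "pell_lucas n =
     (if n = 0 \<or> n = 1 then 2
      else if n > 1 then 2 * pell_lucas (n - 1) + pell_lucas (n - 2)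
      else pell_lucas (n + 2) - 2 * pell_lucas (n + 1))"
  by pat_completeness auto
termination
  by (relation "measure (\<lambda>n. nat \<bar>2 * n - 1\<bar>)") auto

declare pell_lucas.simps [simp del]

lemma pell_lucas_0 [simp]: "pell_lucas 0 = 2"
  and pell_lucas_1 [simp]: "pell_lucas 1 = 2"
  by (simp_all add: pell_lucas.simps)

lemma pell_lucas_rec: "pell_lucas n = 2 * pell_lucas (n - 1) + pell_lucas (n - 2)"
proof (cases "n > 1")
  case True
  then show ?thesis by (subst pell_lucas.simps) simp
next
  case False
  then have "pell_lucas (n - 2) = pell_lucas (n - 2 + 2) - 2 * pell_lucas (n - 2 + 1)"
    by (subst pell_lucas.simps) simp
  then show ?thesis by (simp add: algebra_simps)
qed

lemma pell_lucas_unique: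
  fixes f :: "int \<Rightarrow> int"
  assumes "f 0 = 2" "f 1 = 2" and rec: "\<And>n. f n = 2 * f (n - 1) + f (n - 2)"
  shows "f = pell_lucas"
proof
  fix n
  show "f n = pell_lucas n"
  proof (induction n rule: pell_lucas.induct)
    case (1 n)
    consider "n = 0 \<or> n = 1" | "n > 1" | "n < 0" by linarith
    then show ?case
    proof cases
      case 1
      then show ?thesis using assms(1,2) by auto
    next
      case 2
      then show ?thesis using 1 rec[of n] pell_lucas_rec[of n] by auto
    next
      case 3
      have "f (n + 2) = pell_lucas (n + 2)" "f (n + 1) = pell_lucas (n + 1)"
        using 1 3 by auto
      then show ?thesis
        using rec[of "n + 2"] pell_lucas_rec[of "n + 2"] by (simp add: add.commute)
    qed
  qed
qed

definition pell_lucas_eisenstein :: "nat \<Rightarrow> complex \<Rightarrow> complex" where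
  "pell_lucas_eisenstein m z =
     (\<Sum>\<^sub>\<infinity>j\<in>UNIV. (of_int (pell_lucas j) * z + of_int (pell_lucas (j - 1))) powi (- int m))"

lemma pell_lucas_ge_power: "pell_lucas (int n) \<ge> 2 ^ n"
proof (induction n rule: less_induct)
  case (less n)
  consider "n = 0" | "n = 1" | k where "n = Suc (Suc k)"
    by (metis One_nat_def not0_implies_Suc)
  then show ?case
  proof cases
    case (3 k)
    have "pell_lucas (int n) = 2 * pell_lucas (int (Suc k)) + pell_lucas (int k)"
      using pell_lucas_rec[of "int n"] 3 by simp
    moreover have "pell_lucas (int k) \<ge> 2 ^ k" "pell_lucas (int (Suc k)) \<ge> 2 ^ Suc k"
      using less[of k] less[of "Suc k"] 3 by simp_all
    moreover have "(2::int) ^ k \<ge> 0" by simp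
    ultimately have "pell_lucas (int n) \<ge> 2 * 2 ^ Suc k" by linarith
    then show ?thesis using 3 by simp
  qed auto
qed

lemma pell_lucas_minus: "pell_lucas (- int n) = (-1) ^ n * pell_lucas (int n)"
proof (induction n rule: less_induct)
  case (less n)
  consider "n = 0" | "n = 1" | k where "n = Suc (Suc k)"
    by (metis One_nat_def not0_implies_Suc)
  then show ?case
  proof cases
    case 2
    then show ?thesis using pell_lucas_rec[of 1] by simp
  next
    case (3 k)
    have a: "pell_lucas (int n) = 2 * pell_lucas (int (Suc k)) + pell_lucas (int k)"
      using pell_lucas_rec[of "int n"] 3 by simp
    have "- int k - 1 = - int (Suc k)" "- int k - 2 = - int n"
      using 3 by simp_all
    with pell_lucas_rec[of "- int k"]
    have "pell_lucas (- int k) = 2 * pell_lucas (- int (Suc k)) + pell_lucas (- int n)"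
      by (simp only:)
    then have "pell_lucas (- int n) = pell_lucas (- int k) - 2 * pell_lucas (- int (Suc k))"
      by linarith
    also have "\<dots> = (-1) ^ k * pell_lucas (int k) - 2 * ((-1) ^ Suc k * pell_lucas (int (Suc k)))"
      using less[of k] less[of "Suc k"] 3 by simp
    also have "\<dots> = (-1) ^ n * pell_lucas (int n)"
      unfolding a using 3 by (simp add: algebra_simps)
    finally show ?thesis .
  qed auto
qed

(* infsum returns 0 on families that are not summable; this does not happen here,
   so the infinite sum is the value of the absolutely convergent two-sided series. *)
lemma pell_lucas_eisenstein_abs_summable:
  fixes z :: complex
  assumes "z \<notin> \<real>" "m > 0"
  shows "(\<lambda>j. (of_int (pell_lucas j) * z + of_int (pell_lucas (j - 1))) powi (- int m))
           abs_summable_on (UNIV :: int set)"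
    (is "?f abs_summable_on _")
proof -
  define c where "c = \<bar>Im z\<bar>"
  have c: "c > 0" using assms by (auto simp: c_def complex_is_Real_iff)
  define g where "g j = (1 / c) ^ m * (1 / 2) ^ nat \<bar>j\<bar>" for j :: int
  have ge: "\<bar>pell_lucas j\<bar> \<ge> 2 ^ nat \<bar>j\<bar>" for j
  proof (cases "j \<ge> 0")
    case True
    then show ?thesis using pell_lucas_ge_power[of "nat j"] by simp
  next
    case False
    then show ?thesis
      using pell_lucas_ge_power[of "nat (- j)"] pell_lucas_minus[of "nat (- j)"]
      by (simp add: abs_mult power_abs)
  qed
  have le: "norm (?f j) \<le> g j" for j
  proof -
    let ?w = "of_int (pell_lucas j) * z + of_int (pell_lucas (j - 1)) :: complex"
    have "real_of_int (2 ^ nat \<bar>j\<bar>) \<le> real_of_int \<bar>pell_lucas j\<bar>"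
      by (rule of_int_le_iff[THEN iffD2, OF ge])
    then have "c * 2 ^ nat \<bar>j\<bar> \<le> c * real_of_int \<bar>pell_lucas j\<bar>"
      using c by simp
    also have "\<dots> = \<bar>Im ?w\<bar>" by (simp add: c_def abs_mult)
    also have "\<dots> \<le> norm ?w" by (rule abs_Im_le_cmod)
    finally have w: "c * 2 ^ nat \<bar>j\<bar> \<le> norm ?w" .
    have "norm (?f j) = 1 / norm ?w ^ m"
      by (simp add: power_int_minus norm_inverse norm_power divide_inverse)
    also have "\<dots> \<le> 1 / (c * 2 ^ nat \<bar>j\<bar>) ^ m"
    proof (rule divide_left_mono)
      have "0 < c * 2 ^ nat \<bar>j\<bar>" using c by simp
      moreover from this have "0 < norm ?w" using w by linarith
      ultimately show "0 < norm ?w ^ m * (c * 2 ^ nat \<bar>j\<bar>) ^ m"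
        by (intro mult_pos_pos[OF zero_less_power zero_less_power])
      show "(c * 2 ^ nat \<bar>j\<bar>) ^ m \<le> norm ?w ^ m"
        using c by (intro power_mono w) simp
    qed simp
    also have "\<dots> = (1 / c) ^ m * ((1 / 2) ^ nat \<bar>j\<bar>) ^ m"
      by (simp add: power_mult_distrib power_divide)
    also have "((1 / 2 :: real) ^ nat \<bar>j\<bar>) ^ m \<le> ((1 / 2) ^ nat \<bar>j\<bar>) ^ 1"
      using assms(2) by (intro power_decreasing) (simp_all add: power_le_one)
    then have "(1 / c) ^ m * ((1 / 2) ^ nat \<bar>j\<bar>) ^ m \<le> g j"
      unfolding g_def using c by (intro mult_left_mono) simp_all
    finally show ?thesis .
  qed
  have "summable (\<lambda>n. (1 / c) ^ m * (1 / 2 :: real) ^ n)"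
    by (intro summable_mult summable_geometric) simp
  then have s: "(\<lambda>n. (1 / c) ^ m * (1 / 2 :: real) ^ n) summable_on UNIV"
    using c by (subst summable_on_UNIV_nonneg_real_iff) simp_all
  have "g summable_on {0..}"
  proof -
    have "bij_betw int UNIV {0..}"
      by (rule bij_betw_byWitness[of _ nat]) auto
    from summable_on_reindex_bij_betw[OF this, of g] s show ?thesis
      by (simp add: g_def)
  qed
  moreover have "g summable_on {..<0}"
  proof -
    have "bij_betw (\<lambda>n. - int n) {1..} {..<0}"
      by (rule bij_betw_byWitness[of _ "\<lambda>j. nat (- j)"]) auto
    moreover have "(\<lambda>n. (1 / c) ^ m * (1 / 2 :: real) ^ n) summable_on {1..}"
      by (rule summable_on_subset_banach[OF s]) simp
    ultimately show ?thesis
      using summable_on_reindex_bij_betw[of "\<lambda>n. - int n" "{1..}" "{..<0}" g]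
      by (simp add: g_def)
  qed
  ultimately have "g summable_on ({0..} \<union> {..<0})"
    by (rule summable_on_Un_disjoint) auto
  moreover have "{0..} \<union> {..<0} = (UNIV :: int set)"
    by auto
  ultimately have "g summable_on UNIV" by simp
  then show ?thesis
    by (rule abs_summable_on_comparison_test') (rule le)
qed

end

(* Each of the four substitutions maps the linear form Q j * z + Q (j - 1), up to a sign and the
   automorphy factor, to the linear form of another index, because Q (-j) = (-1)^j * Q j. The even
   exponent removes the sign, so the series is merely reindexed by a bijection of the integers. *)
theory Submission
  imports Defs
begin

text \<open>Either j or -j is a natural number, and \<open>pell_lucas_minus\<close> applies to it.
  Writing the sign as a case split on parity lets the simplifier choose the sign s required by
  \<open>pell_lucas_eisenstein_reindex\<close>.\<close>

lemma pell_lucas_uminus: "pell_lucas (- j) = (if even j then 1 else - 1) * pell_lucas j"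
proof (cases "j \<ge> 0")
  case True
  then show ?thesis
    using pell_lucas_minus[of "nat j"] by (simp add: even_nat_iff uminus_power_if)
next
  case False
  then show ?thesis
    using pell_lucas_minus[of "nat (- j)"] by (auto simp: even_nat_iff uminus_power_if)
qed

lemma pell_lucas_plus1: "pell_lucas (j + 1) = 2 * pell_lucas j + pell_lucas (j - 1)"
  using pell_lucas_rec[of "j + 1"] by simp

lemma pell_lucas_uminus_plus1:
  "pell_lucas (1 - j) = (if even j then - 1 else 1) * pell_lucas (j - 1)"
  using pell_lucas_uminus[of "j - 1"] by simp

lemma pell_lucas_uminus_minus1:
  "pell_lucas (- j - 1) = (if even j then - 1 else 1) * pell_lucas (j + 1)"
  using pell_lucas_uminus[of "j + 1"] by simp

text \<open>The sign s may vary with j since its even power is 1, while c must be the same for all j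
  so that its power factors out of the sum.\<close>

lemma pell_lucas_eisenstein_reindex:
  fixes c w z :: complex and h :: "int \<Rightarrow> int"
  assumes "bij h"
    and form: "\<And>j. \<exists>s\<in>{1, - 1}. of_int (pell_lucas j) * w + of_int (pell_lucas (j - 1)) =
      s * c * (of_int (pell_lucas (h j)) * z + of_int (pell_lucas (h j - 1)))"
  shows "pell_lucas_eisenstein (2 * k) w =
    c powi (- int (2 * k)) * pell_lucas_eisenstein (2 * k) z"
proof -
  let ?f = "\<lambda>j. (of_int (pell_lucas j) * z + of_int (pell_lucas (j - 1))) powi (- int (2 * k))"
  have "(of_int (pell_lucas j) * w + of_int (pell_lucas (j - 1))) powi (- int (2 * k)) =
      c powi (- int (2 * k)) * ?f (h j)" for j
  proof -
    obtain s :: complex where s: "s \<in> {1, - 1}" and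
      eq: "of_int (pell_lucas j) * w + of_int (pell_lucas (j - 1)) =
        s * c * (of_int (pell_lucas (h j)) * z + of_int (pell_lucas (h j - 1)))"
      using form by blast
    have "s powi (- int (2 * k)) = 1"
      using s by (auto simp: power_int_minus simp flip: power_int_of_nat)
    then show ?thesis
      unfolding eq power_int_mult_distrib by simp
  qed
  then have "pell_lucas_eisenstein (2 * k) w = (\<Sum>\<^sub>\<infinity>j. c powi (- int (2 * k)) * ?f (h j))"
    unfolding pell_lucas_eisenstein_def by simp
  also have "\<dots> = (\<Sum>\<^sub>\<infinity>j. c powi (- int (2 * k)) * ?f j)"
    by (rule infsum_reindex_bij_betw) (fact \<open>bij h\<close>)
  also have "\<dots> = c powi (- int (2 * k)) * pell_lucas_eisenstein (2 * k) z"
    unfolding pell_lucas_eisenstein_def by (rule infsum_cmult_right')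
  finally show ?thesis .
qed

theorem theorem3:
  fixes k :: nat and z :: complex
  assumes "k > 0" and "z \<notin> \<real>"
  shows "pell_lucas_eisenstein (2 * k) (- 1 / z) = z ^ (2 * k) * pell_lucas_eisenstein (2 * k) z
    \<and> pell_lucas_eisenstein (2 * k) (2 - z) = pell_lucas_eisenstein (2 * k) z
    \<and> pell_lucas_eisenstein (2 * k) (z + 2) =
        z powi (- int (2 * k)) * pell_lucas_eisenstein (2 * k) (1 / z)
    \<and> pell_lucas_eisenstein (2 * k) (- z) =
        z powi (- int (2 * k)) * pell_lucas_eisenstein (2 * k) (1 / z)"
proof (intro conjI)
  have z: "z \<noteq> 0" using assms(2) by auto
  have bij_minus: "bij (\<lambda>j :: int. a - j)" for a
    by (rule bij_betw_byWitness[of _ "\<lambda>j. a - j"]) auto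
  have bij_plus: "bij (\<lambda>j :: int. j + 1)"
    by (rule bij_betw_byWitness[of _ "\<lambda>j. j - 1"]) auto
  \<comment> \<open>Q j * (-1/z) + Q (j-1) = (1/z) * (Q (j-1) * z - Q j), which up to sign is 1/z
    times the form of index 1 - j.\<close>
  have "pell_lucas_eisenstein (2 * k) (- 1 / z) =
      (1 / z) powi (- int (2 * k)) * pell_lucas_eisenstein (2 * k) z"
    by (rule pell_lucas_eisenstein_reindex[OF bij_minus[of 1]])
      (use z in \<open>auto simp: pell_lucas_uminus pell_lucas_uminus_plus1 field_simps\<close>)
  moreover have "(1 / z) powi (- int (2 * k)) = z ^ (2 * k)"
    unfolding power_int_minus power_int_of_nat by (simp add: power_one_over)
  ultimately show "pell_lucas_eisenstein (2 * k) (- 1 / z) =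
      z ^ (2 * k) * pell_lucas_eisenstein (2 * k) z"
    by simp
  \<comment> \<open>By the recurrence the form at 2 - z is Q (j+1) - Q j * z, up to sign the form of
    index -j at z.\<close>
  have "pell_lucas_eisenstein (2 * k) (2 - z) =
      1 powi (- int (2 * k)) * pell_lucas_eisenstein (2 * k) z"
    by (rule pell_lucas_eisenstein_reindex[OF bij_minus[of 0]])
      (auto simp: pell_lucas_uminus pell_lucas_uminus_minus1 pell_lucas_plus1 algebra_simps)
  then show "pell_lucas_eisenstein (2 * k) (2 - z) = pell_lucas_eisenstein (2 * k) z"
    by simp
  \<comment> \<open>The recurrence turns the form at z + 2 into Q j * z + Q (j+1) = z * (Q (j+1) / z
    + Q j): a shift of the index, with no sign.\<close>
  show "pell_lucas_eisenstein (2 * k) (z + 2) =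
      z powi (- int (2 * k)) * pell_lucas_eisenstein (2 * k) (1 / z)"
    by (rule pell_lucas_eisenstein_reindex[OF bij_plus])
      (use z in \<open>simp add: pell_lucas_plus1 field_simps\<close>)
  \<comment> \<open>Q (j-1) - Q j * z = z * (Q (j-1) / z - Q j), up to sign z times the form of
    index 1 - j at 1/z.\<close>
  show "pell_lucas_eisenstein (2 * k) (- z) =
      z powi (- int (2 * k)) * pell_lucas_eisenstein (2 * k) (1 / z)"
    by (rule pell_lucas_eisenstein_reindex[OF bij_minus[of 1]])
      (use z in \<open>auto simp: pell_lucas_uminus pell_lucas_uminus_plus1 field_simps\<close>)
qed

end
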